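(* Let $d,D\in\mathbb{Z}$ with $d<D$. Then $(\mathbb{Z},-2,\{d,D\})$ is a number system if and only if all of the following hold: (i) one of $d,D$ is even and the other is odd; (ii) neither $d$ nor $D$ is divisible by $3$, except that the even digit is allowed to be $0$; (iii) $2d\le D$ and $2D\ge d$; (iv) $D-d=3^i$ for some integer $i\ge 0$.
   Context: A pre-number system $(\mathbb{Z},b,\mathcal{D})$ consists of an integer $b$ with $|b|\ge 2$ and a finite set $\mathcal{D}\subset\mathbb{Z}$ containing a representative of every residue class modulo $b$. It is a number system if every $a\in\mathbb{Z}$ can be written as $a=\sum_{i=0}^{\ell-1}d_ib^i$ with $\ell\ge 1$ and all $d_i\in\mathcal{D}$. (A triple that is not a pre-number system is not a number system.) *)

theory Defs
  imports "HOL-Number_Theory.Cong"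
begin

definition pre_number_system :: "int \<Rightarrow> int set \<Rightarrow> bool" where
  "pre_number_system b \<D> \<longleftrightarrow>
     \<bar>b\<bar> \<ge> 2 \<and> finite \<D> \<and> (\<forall>a. \<exists>x\<in>\<D>. [x = a] (mod b))"

text \<open>Only the values \<open>c i\<close> with \<open>i < l\<close> matter. Since \<open>l \<ge> 1\<close>, the integer 0 also needs a
  nonempty expansion.\<close>

definition number_system :: "int \<Rightarrow> int set \<Rightarrow> bool" where
  "number_system b \<D> \<longleftrightarrow>
     pre_number_system b \<D> \<and>
     (\<forall>a. \<exists>(l::nat) (c::nat \<Rightarrow> int).
        l \<ge> 1 \<and> (\<forall>i<l. c i \<in> \<D>) \<and> a = (\<Sum>i<l. c i * b ^ i))"

end

theory Submission
  imports Defs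
begin

text \<open>
  Peeling off the last digit is the map \<open>T x = (c - x) / 2\<close>, where \<open>c \<in> {d, D}\<close> has the parity
  of \<open>x\<close>; the triple is a number system iff every \<open>T\<close>-orbit hits 0 after at least one step.
  The real interval from \<open>(2 d - D) / 3\<close> to \<open>(2 D - d) / 3\<close>, of length \<open>D - d\<close>, is
  \<open>T\<close>-invariant, and \<open>T\<close> halves the distance to it; so 0 can only return to itself if it lies in
  the interval. A fixed point of \<open>T\<close> is a third of a digit. If \<open>q\<close> divides \<open>D - d\<close>, then \<open>T\<close> is
  affine modulo \<open>q\<close>, with a fixed point when 3 is invertible, which rules out \<open>q > 1\<close> prime to 3.
  Conversely, let \<open>D - d = 3 ^ i\<close>. In the coordinate \<open>y = d - 3 x\<close> modulo \<open>3 ^ (i + 1)\<close> the map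
  \<open>T\<close> is division by \<open>-2\<close>, and \<open>-2\<close> generates the residues congruent to 1 modulo 3. Hence every
  orbit meets the multiples of \<open>3 ^ i\<close>, and 0 is the only one in the interval.
\<close>

section \<open>Expansions as orbits of the digit map\<close>

definition digit_step :: "int \<Rightarrow> int \<Rightarrow> int \<Rightarrow> int" where
  "digit_step d D x = ((if even (x - d) then d else D) - x) div 2"

lemma digit_step_cases:
  fixes d D x :: int
  assumes "odd (D - d)"
  obtains "2 * digit_step d D x = d - x" | "2 * digit_step d D x = D - x"
proof (cases "even (x - d)")
  case True
  then have "2 * digit_step d D x = d - x"
    by (auto simp: digit_step_def)
  then show ?thesis using that by blast
next
  case False
  with assms have "2 * digit_step d D x = D - x"
    by (auto simp: digit_step_def)
  then show ?thesis using that by blast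
qed

lemma digit_step_eqI:
  fixes d D c x y :: int
  assumes "odd (D - d)" and "c \<in> {d, D}" and "x = c - 2 * y"
  shows "digit_step d D x = y"
  using assms by (auto simp: digit_step_def)

text \<open>Parity forces the last digit, and with it the remaining quotient. Lengths match exactly,
  so the requirement \<open>l \<ge> 1\<close> carries over to orbits.\<close>

lemma expansion_iff_orbit:
  fixes d D a :: int
  assumes odd: "odd (D - d)"
  shows "(\<exists>c::nat \<Rightarrow> int. (\<forall>i<l. c i \<in> {d, D}) \<and> a = (\<Sum>i<l. c i * (-2) ^ i)) \<longleftrightarrow>
    (digit_step d D ^^ l) a = 0"
proof (induction l arbitrary: a)
  case 0
  then show ?case by simp
next
  case (Suc l)
  show ?case
  proof
    assume "\<exists>c::nat \<Rightarrow> int. (\<forall>i<Suc l. c i \<in> {d, D}) \<and> a = (\<Sum>i<Suc l. c i * (-2) ^ i)"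
    then obtain c :: "nat \<Rightarrow> int"
      where c: "\<forall>i<Suc l. c i \<in> {d, D}" and a: "a = (\<Sum>i<Suc l. c i * (-2) ^ i)"
      by blast
    define b where "b = (\<Sum>i<l. c (Suc i) * (-2) ^ i)"
    have "a = c 0 - 2 * b"
      unfolding a b_def sum.lessThan_Suc_shift by (simp add: sum_distrib_left mult_ac sum_negf)
    then have "digit_step d D a = b"
      using digit_step_eqI[OF odd] c by blast
    moreover have "(digit_step d D ^^ l) b = 0"
      using Suc.IH[of b] c by (auto simp: b_def intro!: exI[of _ "\<lambda>i. c (Suc i)"])
    ultimately show "(digit_step d D ^^ Suc l) a = 0"
      by (simp add: funpow_Suc_right del: funpow.simps)
  next
    assume "(digit_step d D ^^ Suc l) a = 0"
    then have "(digit_step d D ^^ l) (digit_step d D a) = 0"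
      by (simp add: funpow_Suc_right del: funpow.simps)
    then obtain c :: "nat \<Rightarrow> int" where c: "\<forall>i<l. c i \<in> {d, D}"
      and b: "digit_step d D a = (\<Sum>i<l. c i * (-2) ^ i)"
      using Suc.IH by blast
    obtain e where e: "e \<in> {d, D}" "a = e - 2 * digit_step d D a"
      by (rule digit_step_cases[OF odd, of a]) auto
    define c' where "c' i = (case i of 0 \<Rightarrow> e | Suc j \<Rightarrow> c j)" for i
    have "\<forall>i<Suc l. c' i \<in> {d, D}"
      using c e(1) by (auto simp: c'_def split: nat.split)
    moreover have "a = (\<Sum>i<Suc l. c' i * (-2) ^ i)"
    proof -
      have "(\<Sum>i<Suc l. c' i * (-2) ^ i) = e - 2 * (\<Sum>i<l. c i * (-2) ^ i)"
        unfolding sum.lessThan_Suc_shift by (simp add: c'_def sum_distrib_left mult_ac sum_negf)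
      with e(2) b show ?thesis by simp
    qed
    ultimately show "\<exists>c::nat \<Rightarrow> int. (\<forall>i<Suc l. c i \<in> {d, D}) \<and> a = (\<Sum>i<Suc l. c i * (-2) ^ i)"
      by blast
  qed
qed

lemma pre_number_system_neg2_iff:
  fixes d D :: int
  shows "pre_number_system (-2) {d, D} \<longleftrightarrow> odd (D - d)"
proof
  assume "pre_number_system (-2) {d, D}"
  then have *: "\<exists>x\<in>{d, D}. [x = a] (mod (-2))" for a
    by (auto simp: pre_number_system_def)
  show "odd (D - d)"
    using *[of 0] *[of 1] by (auto simp: cong_iff_dvd_diff)
next
  assume "odd (D - d)"
  then show "pre_number_system (-2) {d, D}"
    by (auto simp: pre_number_system_def cong_iff_dvd_diff)
qed

lemma number_system_neg2_iff:
  fixes d D :: int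
  shows "number_system (-2) {d, D} \<longleftrightarrow>
    odd (D - d) \<and> (\<forall>a. \<exists>l\<ge>1. (digit_step d D ^^ l) a = 0)"
proof -
  have "(\<exists>(l::nat) c. l \<ge> 1 \<and> (\<forall>i<l. c i \<in> {d, D}) \<and> a = (\<Sum>i<l. c i * (-2) ^ i)) \<longleftrightarrow>
      (\<exists>l\<ge>1. (digit_step d D ^^ l) a = 0)" if "odd (D - d)" for a
    unfolding expansion_iff_orbit[OF that, symmetric] by blast
  then show ?thesis
    unfolding number_system_def pre_number_system_neg2_iff by blast
qed

section \<open>The attracting interval\<close>

lemma funpow_invariant:
  assumes "P a" and "\<And>x. P x \<Longrightarrow> P (f x)"
  shows "P ((f ^^ n) a)"
  by (induction n) (use assms in auto)

text \<open>Scaling by 3 keeps the ends integral; \<open>t\<close> is three times the permitted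
  distance from the interval.\<close>

definition near_attractor :: "int \<Rightarrow> int \<Rightarrow> int \<Rightarrow> int \<Rightarrow> bool" where
  "near_attractor d D t x \<longleftrightarrow> 2 * d - D - t \<le> 3 * x \<and> 3 * x \<le> 2 * D - d + t"

text \<open>The map has slope -1/2, so each end of the range for \<open>x\<close> bounds the image
  at the opposite end; integrality of the image allows rounding \<open>t / 2\<close> down.\<close>

lemma near_attractor_step:
  assumes "odd (D - d)" and "d < D" and "near_attractor d D t x"
  shows "near_attractor d D (t div 2) (digit_step d D x)"
  using assms(2,3) unfolding near_attractor_def
  by (rule_tac digit_step_cases[OF assms(1), of x]) linarith+

lemma near_attractor_mono:
  "near_attractor d D s x \<Longrightarrow> s \<le> t \<Longrightarrow> near_attractor d D t x"
  by (auto simp: near_attractor_def)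

lemma orbit_reaches_attractor:
  assumes "odd (D - d)" and "d < D"
  shows "\<exists>l. near_attractor d D 0 ((digit_step d D ^^ l) x)"
proof -
  have "\<exists>l. near_attractor d D 0 ((digit_step d D ^^ l) x)"
    if "near_attractor d D (int n) x" for n x
    using that
  proof (induction n arbitrary: x rule: less_induct)
    case (less n)
    show ?case
    proof (cases "n = 0")
      case True
      with less.prems show ?thesis by (intro exI[of _ 0]) simp
    next
      case False
      have "near_attractor d D (int (n div 2)) (digit_step d D x)"
        using near_attractor_step[OF assms less.prems] by (simp add: zdiv_int)
      moreover have "n div 2 < n" using False by simp
      ultimately obtain l where "near_attractor d D 0 ((digit_step d D ^^ l) (digit_step d D x))"
        using less.IH by blast
      then show ?thesis
        by (intro exI[of _ "Suc l"]) (simp add: funpow_Suc_right del: funpow.simps)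
    qed
  qed
  moreover have "near_attractor d D (int (nat (\<bar>2 * d - D\<bar> + \<bar>2 * D - d\<bar> + 3 * \<bar>x\<bar>))) x"
    unfolding near_attractor_def by linarith
  ultimately show ?thesis by blast
qed

lemma recurrent_zero_in_attractor:
  assumes odd: "odd (D - d)" and less: "d < D"
    and "l \<ge> 1" and ret: "(digit_step d D ^^ l) 0 = 0"
  shows "2 * d \<le> D \<and> 2 * D \<ge> d"
proof (rule ccontr)
  assume neg: "\<not> ?thesis"
  \<comment> \<open>The least \<open>t\<close> for which 0 satisfies
    \<open>near_attractor d D t\<close>. After one step the orbit satisfies the strictly smaller
    bound \<open>t div 2\<close> for good, so it cannot return to 0.\<close>
  define t where "t = max (2 * d - D) (d - 2 * D)"
  have t: "t > 0" using neg by (auto simp: t_def)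
  have "near_attractor d D t 0" by (auto simp: near_attractor_def t_def)
  then have "near_attractor d D (t div 2) (digit_step d D 0)"
    by (rule near_attractor_step[OF odd less])
  then have "near_attractor d D (t div 2) ((digit_step d D ^^ (l - 1)) (digit_step d D 0))"
  proof (rule funpow_invariant)
    fix x assume "near_attractor d D (t div 2) x"
    then have "near_attractor d D (t div 2 div 2) (digit_step d D x)"
      by (rule near_attractor_step[OF odd less])
    then show "near_attractor d D (t div 2) (digit_step d D x)"
      by (rule near_attractor_mono) (use t in linarith)
  qed
  moreover have "(digit_step d D ^^ (l - 1)) (digit_step d D 0) = (digit_step d D ^^ l) 0"
    using \<open>l \<ge> 1\<close> by (cases l) (simp_all add: funpow_Suc_right del: funpow.simps)
  ultimately have "near_attractor d D (t div 2) 0"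
    using ret by simp
  then have "t \<le> t div 2"
    by (auto simp: near_attractor_def t_def)
  with t show False by linarith
qed

section \<open>Necessity: fixed points and divisors of the digits\<close>

lemma third_of_digit_fixed:
  fixes d D x :: int
  assumes "odd (D - d)" and "c \<in> {d, D}" and "c = 3 * x"
  shows "(digit_step d D ^^ l) x = x"
proof -
  have "digit_step d D x = x"
    by (rule digit_step_eqI[OF assms(1,2)]) (use assms(3) in simp)
  then show ?thesis by (induction l) auto
qed

text \<open>A solution \<open>a\<close> of \<open>3 * a = d\<close> modulo \<open>q\<close> is fixed
  by the digit map modulo \<open>q\<close>. Its orbit stays in one residue class, and that class
  contains 0.\<close>

lemma divisor_coprime_3_dvd_digit:
  fixes d D q :: int
  assumes odd: "odd (D - d)" and q: "q dvd D - d" and cop: "coprime 3 q"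
    and orbit: "\<And>a. \<exists>l. (digit_step d D ^^ l) a = 0"
  shows "q dvd d"
proof -
  have "odd q" using odd q by (meson dvd_trans)
  obtain a where a: "[3 * a = d] (mod q)"
    using cong_solve_coprime_int[OF cop] by (metis cong_scalar_right mult.assoc mult_1)
  obtain l where l: "(digit_step d D ^^ l) a = 0" using orbit by blast
  have "q dvd 3 * ((digit_step d D ^^ l) a) - d"
  proof (rule funpow_invariant)
    show "q dvd 3 * a - d" using a by (simp add: cong_iff_dvd_diff)
  next
    fix x assume x: "q dvd 3 * x - d"
    \<comment> \<open>\<open>k\<close> is 0 when the digit is \<open>d\<close> and 1 when it is
      \<open>D\<close>.\<close>
    obtain k where "2 * (3 * digit_step d D x - d) = 3 * k * (D - d) - (3 * x - d)"
      by (rule digit_step_cases[OF odd, of x]; rule that[of 0] that[of 1]; simp)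
    then have "q dvd 2 * (3 * digit_step d D x - d)"
      using q x by (metis dvd_diff dvd_mult)
    moreover have "coprime q 2" using \<open>odd q\<close> by simp
    ultimately show "q dvd 3 * digit_step d D x - d"
      using coprime_dvd_mult_right_iff by blast
  qed
  with l show ?thesis by simp
qed

text \<open>A common divisor of the digits divides every expansion, in particular one of 1.\<close>

lemma number_system_gcd_digits:
  fixes d D q :: int
  assumes "number_system b {d, D}" and "q dvd d" and "q dvd D"
  shows "is_unit q"
proof -
  from assms(1) have "\<exists>(l::nat) c. l \<ge> 1 \<and> (\<forall>i<l. c i \<in> {d, D}) \<and> 1 = (\<Sum>i<l. c i * b ^ i)"
    unfolding number_system_def by blast
  then obtain l :: nat and c where c: "\<forall>i<l. c i \<in> {d, D}" and "1 = (\<Sum>i<l. c i * b ^ i)"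
    by blast
  moreover have "q dvd (\<Sum>i<l. c i * b ^ i)"
    using c assms(2,3) by (intro dvd_sum dvd_mult2) auto
  ultimately show ?thesis by simp
qed

lemma number_system_diff_power_3:
  fixes d D :: int
  assumes ns: "number_system (-2) {d, D}" and less: "d < D"
  shows "\<exists>i::nat. D - d = 3 ^ i"
proof -
  have odd: "odd (D - d)" and orbit: "\<And>a. \<exists>l. (digit_step d D ^^ l) a = 0"
    using ns by (auto simp: number_system_neg2_iff)
  have "D - d \<noteq> 0" "\<not> is_unit (3::int)" using less by auto
  \<comment> \<open>\<open>q\<close> is the part of \<open>D - d\<close> prime to 3; it turns out to
    divide both digits, hence to be 1.\<close>
  then obtain q where q: "D - d = 3 ^ multiplicity 3 (D - d) * q" "\<not> 3 dvd q"
    using multiplicity_decompose'[of "D - d" 3] by metis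
  have "coprime 3 q"
    using q(2) by (intro prime_imp_coprime) auto
  moreover have q_dvd: "q dvd D - d" using q(1) by (metis dvd_triv_right)
  ultimately have "q dvd d"
    using divisor_coprime_3_dvd_digit[OF odd _ _ orbit] by blast
  moreover from this have "q dvd D" using q_dvd by (simp add: dvd_diff_left_iff)
  ultimately have "is_unit q"
    using number_system_gcd_digits[OF ns] by blast
  moreover have "q > 0"
    using q(1) less by (metis diff_gt_0_iff_gt zero_less_mult_pos zero_less_numeral zero_less_power)
  ultimately have "q = 1" by simp
  with q(1) show ?thesis by (metis mult.right_neutral)
qed

section \<open>Powers of -2 modulo powers of 3\<close>

lemma neg2_power_power_3:
  "\<exists>u::int. (-2) ^ (3 ^ n) = 1 + 3 ^ Suc n * u \<and> \<not> 3 dvd u"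
proof (induction n)
  case 0
  show ?case by (intro exI[of _ "-1"]) simp
next
  case (Suc n)
  then obtain u :: int where u: "(-2) ^ (3 ^ n) = 1 + 3 ^ Suc n * u" "\<not> 3 dvd u" by blast
  define s :: int where "s = 3 ^ n"
  \<comment> \<open>Read off from expanding the cube. As \<open>u'\<close> is congruent to
    \<open>u\<close> modulo 3, cubing gains exactly one factor 3.\<close>
  define u' where "u' = u + 3 * (s * u\<^sup>2 + s\<^sup>2 * u ^ 3)"
  have "(-2::int) ^ (3 ^ Suc n) = ((-2) ^ (3 ^ n)) ^ 3"
    by (simp add: power_mult[symmetric] mult.commute)
  also have "\<dots> = (1 + 3 * s * u) ^ 3" by (simp add: u s_def)
  also have "\<dots> = 1 + 9 * s * u'"
    unfolding u'_def by algebra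
  finally have "(-2::int) ^ (3 ^ Suc n) = 1 + 3 ^ Suc (Suc n) * u'" by (simp add: s_def)
  moreover have "\<not> 3 dvd u'" unfolding u'_def using u(2) by presburger
  ultimately show ?case by blast
qed

text \<open>Lifting one power of 3 at a time: adding \<open>3 ^ n\<close> to the exponent changes
  the quotient by a nonzero amount modulo 3, the same each time, so one of \<open>l\<close>,
  \<open>l + 3 ^ n\<close>, \<open>l + 2 * 3 ^ n\<close> works.\<close>

lemma neg2_powers_cover:
  fixes y d :: int
  assumes "3 dvd y - d" and "\<not> 3 dvd d"
  shows "\<exists>l. 3 ^ Suc n dvd y - (-2) ^ l * d"
proof (induction n)
  case 0
  show ?case using assms by (intro exI[of _ 0]) simp
next
  case (Suc n)
  then obtain l w where w: "y - (-2) ^ l * d = 3 ^ Suc n * w" by (elim exE dvdE)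
  obtain u :: int where u: "(-2) ^ (3 ^ n) = 1 + 3 ^ Suc n * u" "\<not> 3 dvd u"
    using neg2_power_power_3 by blast
  have shift: "y - (-2) ^ (k + 3 ^ n) * d = 3 ^ Suc n * (v - u * (-2) ^ k * d)"
    if "y - (-2) ^ k * d = 3 ^ Suc n * v" for k v
    using that unfolding power_add u(1) by (simp add: algebra_simps)
  let ?v = "u * (-2) ^ l * d"
  let ?l1 = "l + 3 ^ n"
  let ?v1 = "u * (-2) ^ ?l1 * d"
  have p3: "prime (3::int)" by simp
  have "\<not> (3::int) dvd (-2) ^ l" using prime_dvd_power_int[OF p3, of "-2" l] by auto
  then have v: "\<not> 3 dvd ?v"
    using u(2) assms(2) prime_dvd_mult_iff[OF p3] by blast
  have w1: "y - (-2) ^ ?l1 * d = 3 ^ Suc n * (w - ?v)"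
    using shift[OF w] by blast
  have w2: "y - (-2) ^ (?l1 + 3 ^ n) * d = 3 ^ Suc n * (w - ?v - ?v1)"
    using shift[OF w1] by blast
  have "?v1 = ?v + 3 * (3 ^ n * u * ?v)"
    unfolding power_add u(1) by (simp add: algebra_simps)
  then have "3 dvd w \<or> 3 dvd w - ?v \<or> 3 dvd w - ?v - ?v1"
    using v by presburger
  moreover have "3 ^ Suc (Suc n) dvd y - (-2) ^ k * d"
    if "y - (-2) ^ k * d = 3 ^ Suc n * v" "3 dvd v" for k v
    using that by (metis dvd_refl mult_dvd_mono power_Suc2)
  ultimately show ?case using w w1 w2 by blast
qed

text \<open>With \<open>y = d - 3 * x\<close>, the target \<open>3 ^ i dvd x\<close> reads:
  \<open>y\<close> is congruent to \<open>d\<close> modulo \<open>3 ^ Suc i\<close>. Every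
  \<open>y\<close> is congruent to \<open>d\<close> modulo 3, so some power of -2 times
  \<open>d\<close> matches the starting value.\<close>

lemma orbit_reaches_multiple:
  fixes d D a :: int
  assumes m: "D - d = 3 ^ i" and d: "\<not> 3 dvd d"
  shows "\<exists>l. 3 ^ i dvd (digit_step d D ^^ l) a"
proof -
  have odd: "odd (D - d)" unfolding m by simp
  have "3 dvd (d - 3 * a) - d" by simp
  then obtain l where l: "3 ^ Suc i dvd (d - 3 * a) - (-2) ^ l * d"
    using neg2_powers_cover[OF _ d] by blast
  \<comment> \<open>Multiplying the later value by \<open>(-2) ^ k\<close> replaces division by -2
    in the residue ring.\<close>
  have orbit: "3 ^ Suc i dvd (d - 3 * a) - (-2) ^ k * (d - 3 * (digit_step d D ^^ k) a)" for k
  proof (induction k)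
    case 0
    show ?case by simp
  next
    case (Suc k)
    define x where "x = (digit_step d D ^^ k) a"
    \<comment> \<open>\<open>e\<close> is 0 or 1 according to the digit; the factor 3 before
      \<open>e\<close> raises the modulus from \<open>3 ^ i\<close> to
      \<open>3 ^ Suc i\<close>.\<close>
    obtain e where e: "-2 * (d - 3 * digit_step d D x) = d - 3 * x + 3 * e * (D - d)"
      by (rule digit_step_cases[OF odd, of x]; rule that[of 0] that[of 1]; simp)
    have "(-2) ^ Suc k * (d - 3 * digit_step d D x) = (-2) ^ k * (-2 * (d - 3 * digit_step d D x))"
      by (simp only: power_Suc2 mult.assoc)
    also have "\<dots> = (-2) ^ k * (d - 3 * x) + 3 ^ Suc i * ((-2) ^ k * e)"
      unfolding e m by (simp add: algebra_simps)
    finally have "(d - 3 * a) - (-2) ^ Suc k * (d - 3 * digit_step d D x)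
      = ((d - 3 * a) - (-2) ^ k * (d - 3 * x)) - 3 ^ Suc i * ((-2) ^ k * e)"
      by simp
    moreover have "3 ^ Suc i dvd \<dots>"
      using Suc.IH unfolding x_def by (rule dvd_diff) (rule dvd_triv_left)
    ultimately show ?case
      by (simp only: x_def funpow.simps comp_apply)
  qed
  define x where "x = (digit_step d D ^^ l) a"
  have "3 ^ Suc i dvd ((d - 3 * a) - (-2) ^ l * d) - ((d - 3 * a) - (-2) ^ l * (d - 3 * x))"
    using l orbit[of l] unfolding x_def by (rule dvd_diff)
  then have "3 ^ Suc i dvd (-2) ^ l * (3 * x)"
    by (simp add: algebra_simps)
  moreover have "coprime (3 ^ Suc i) ((-2::int) ^ l)"
    by (intro coprime_power_left_iff[THEN iffD2] coprime_power_right_iff[THEN iffD2] disjI1) simp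
  ultimately have "3 ^ Suc i dvd 3 * x"
    using coprime_dvd_mult_right_iff by blast
  then show ?thesis unfolding x_def by auto
qed

section \<open>Sufficiency: every orbit reaches 0\<close>

lemma orbit_reaches_zero:
  fixes d D a :: int
  assumes m: "D - d = 3 ^ i" and "i > 0" and d: "\<not> 3 dvd d"
    and iii: "2 * d \<le> D" "2 * D \<ge> d"
  shows "\<exists>l. (digit_step d D ^^ l) a = 0"
proof -
  have odd: "odd (D - d)" unfolding m by simp
  have less: "d < D" using m by (metis diff_gt_0_iff_gt zero_less_numeral zero_less_power)
  obtain l1 where l1: "near_attractor d D 0 ((digit_step d D ^^ l1) a)"
    using orbit_reaches_attractor[OF odd less] by blast
  obtain l2 where l2: "3 ^ i dvd (digit_step d D ^^ l2) ((digit_step d D ^^ l1) a)"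
    using orbit_reaches_multiple[OF m d] by blast
  define x where "x = (digit_step d D ^^ l2) ((digit_step d D ^^ l1) a)"
  have "near_attractor d D 0 x" unfolding x_def
    by (rule funpow_invariant[where P = "near_attractor d D 0", OF l1]) (use near_attractor_step[OF odd less, of 0] in simp)
  then have bounds: "2 * d - D \<le> 3 * x" "3 * x \<le> 2 * D - d"
    by (auto simp: near_attractor_def)
  have dvd3: "3 dvd D - d" using m \<open>i > 0\<close> by simp
  \<comment> \<open>Both \<open>2 * D - d\<close> and \<open>2 * d - D\<close> are nonzero modulo 3,
    so the interval has no integer end. This excludes the multiples \<open>3 ^ i\<close> and
    \<open>- (3 ^ i)\<close>.\<close>
  with d have "3 * x \<noteq> 2 * D - d" "3 * x \<noteq> 2 * d - D"
    by presburger+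
  with bounds have "2 * d - D < 3 * x" "3 * x < 2 * D - d" by auto
  with iii have "x < D - d" "- x < D - d" by linarith+
  then have "\<bar>x\<bar> < 3 ^ i" unfolding m by linarith
  moreover have "3 ^ i dvd x" using l2 by (simp add: x_def)
  ultimately have "x = 0" using dvd_imp_le_int[of x "3 ^ i"] by (cases "x = 0") auto
  then have "(digit_step d D ^^ (l2 + l1)) a = 0" by (simp add: x_def funpow_add)
  then show ?thesis ..
qed

lemma orbit_reaches_zero_consecutive:
  fixes d a :: int
  assumes "d \<in> {-2, -1, 0, 1}"
  shows "\<exists>l. (digit_step d (d + 1) ^^ l) a = 0"
proof -
  obtain l where l: "near_attractor d (d + 1) 0 ((digit_step d (d + 1) ^^ l) a)"
    using orbit_reaches_attractor[of "d + 1" d a] by auto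
  define x where "x = (digit_step d (d + 1) ^^ l) a"
  \<comment> \<open>For \<open>d\<close> equal to -1 or 0 the interval contains only the integer 0.
    For -2 and 1 the other integer in it is the odd digit itself, which is sent to 0.\<close>
  have "x = 0 \<or> (digit_step d (d + 1) x) = 0"
    using l assms unfolding x_def[symmetric] near_attractor_def digit_step_def by auto
  then show ?thesis
    unfolding x_def by (metis funpow.simps(2) comp_apply)
qed

theorem theorem4p1:
  fixes d D :: int
  assumes "d < D"
  shows "number_system (-2) {d, D} \<longleftrightarrow>
     ((even d \<and> odd D) \<or> (odd d \<and> even D)) \<and>
     (\<forall>x\<in>{d, D}. \<not> 3 dvd x \<or> (even x \<and> x = 0)) \<and>
     (2 * d \<le> D \<and> 2 * D \<ge> d) \<and>
     (\<exists>i::nat. D - d = 3 ^ i)"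
proof
  assume ns: "number_system (-2) {d, D}"
  then have odd: "odd (D - d)" and orbit: "\<And>a. \<exists>l\<ge>1. (digit_step d D ^^ l) a = 0"
    by (auto simp: number_system_neg2_iff)
  have "\<not> 3 dvd x \<or> (even x \<and> x = 0)" if "x \<in> {d, D}" for x
    \<comment> \<open>A third of a digit divisible by 3 is fixed, so its orbit meets 0 only if the
      digit is 0.\<close>
    using third_of_digit_fixed[OF odd that] orbit by (metis dvdE even_zero mult_zero_right)
  moreover have "2 * d \<le> D \<and> 2 * D \<ge> d"
    using recurrent_zero_in_attractor[OF odd assms] orbit by blast
  moreover have "(even d \<and> odd D) \<or> (odd d \<and> even D)"
    using odd by auto
  ultimately show "((even d \<and> odd D) \<or> (odd d \<and> even D)) \<and>
     (\<forall>x\<in>{d, D}. \<not> 3 dvd x \<or> (even x \<and> x = 0)) \<and>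
     (2 * d \<le> D \<and> 2 * D \<ge> d) \<and> (\<exists>i::nat. D - d = 3 ^ i)"
    using number_system_diff_power_3[OF ns assms] by blast
next
  assume rhs: "((even d \<and> odd D) \<or> (odd d \<and> even D)) \<and>
     (\<forall>x\<in>{d, D}. \<not> 3 dvd x \<or> (even x \<and> x = 0)) \<and>
     (2 * d \<le> D \<and> 2 * D \<ge> d) \<and> (\<exists>i::nat. D - d = 3 ^ i)"
  then obtain i :: nat where i: "D - d = 3 ^ i" by blast
  have orbit: "\<exists>l. (digit_step d D ^^ l) a = 0" for a
  proof (cases "i = 0")
    case True
    with i have D: "D = d + 1" by simp
    with rhs have "d \<in> {-2, -1, 0, 1}" by auto
    then show ?thesis unfolding D by (rule orbit_reaches_zero_consecutive)
  next
    case False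
    then have dvd3: "3 dvd D - d" using i by simp
    have "\<not> 3 dvd d"
    proof
      assume "3 dvd d"
      moreover from this have "3 dvd D" using dvd3 by presburger
      ultimately have "d = 0" "D = 0" using rhs by auto
      with assms show False by simp
    qed
    with False i rhs show ?thesis by (intro orbit_reaches_zero) auto
  qed
  \<comment> \<open>Starting from the image of \<open>a\<close> guarantees at least one step, also
    when \<open>a\<close> is 0.\<close>
  have "\<exists>l\<ge>1. (digit_step d D ^^ l) a = 0" for a
  proof -
    obtain l where "(digit_step d D ^^ l) (digit_step d D a) = 0" using orbit by blast
    then show ?thesis
      by (intro exI[of _ "Suc l"]) (simp add: funpow_Suc_right del: funpow.simps)
  qed
  then show "number_system (-2) {d, D}"
    using i by (simp add: number_system_neg2_iff)
qed

end
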